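(* Let $P$ be a finite poset and let $I\in\mathcal{IC}(P)$. Then \[ \mathrm{Row}(I) = \Big( \mathrm{Inc}(\lceil I\rceil) - I \Big)\cup\Big(\Delta\lceil I\rceil-\Delta\big(\mathrm{Min}(I)\cap\Delta\lceil I\rceil\big) \Big). \]
   Context: A subset $I$ of a finite poset $P$ is interval-closed if whenever $x,y\in I$, $z\in P$ and $x\le z\le y$, then $z\in I$; $\mathcal{IC}(P)$ denotes the set of interval-closed sets of $P$. For $x\in P$, the toggle $t_x:\mathcal{IC}(P)\to\mathcal{IC}(P)$ sends $I$ to $I\setminus\{x\}$ if $x\in I$ and $I\setminus\{x\}\in\mathcal{IC}(P)$, to $I\cup\{x\}$ if $x\notin I$ and $I\cup\{x\}\in\mathcal{IC}(P)$, and to $I$ otherwise. Rowmotion is $\mathrm{Row}=t_{x_1}\circ t_{x_2}\circ\cdots\circ t_{x_N}$, where $x_1,\dots,x_N$ is any linear extension of $P$ (so toggles are applied in the reverse order of the linear extension, top to bottom); this does not depend on the linear extension chosen. For $S\subseteq P$: $\Delta(S)=\{y\in P: y\le s \text{ for some } s\in S\}$ is the smallest order ideal containing $S$; $\nabla(S)=\{y\in P: y\ge s\text{ for some } s\in S\}$ is the smallest order filter containing $S$; $\mathrm{Min}(S)$ is the set of minimal elements of $S$; $\mathrm{Inc}(S)$ is the set of elements of $P$ incomparable with every element of $S$. The ceiling of $I$ is $\lceil I\rceil=\mathrm{Min}(\nabla(I)-I)$. We write $\Delta\lceil I\rceil$ for $\Delta(\lceil I\rceil)$. *)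

theory Defs
  imports Main
begin

text \<open>
  A finite poset is a finite set \<open>P\<close> with a relation \<open>r\<close> such that \<open>partial_order_on P r\<close>
  holds; \<open>(x, y) \<in> r\<close> means \<open>x \<le> y\<close>. In particular \<open>r\<close> is reflexive on \<open>P\<close> and
  contained in \<open>P \<times> P\<close>. The empty poset is allowed.
\<close>

definition interval_closed :: "'a set \<Rightarrow> 'a rel \<Rightarrow> 'a set \<Rightarrow> bool" where
  "interval_closed P r I \<longleftrightarrow>
     I \<subseteq> P \<and> (\<forall>x\<in>I. \<forall>y\<in>I. \<forall>z\<in>P. (x, z) \<in> r \<and> (z, y) \<in> r \<longrightarrow> z \<in> I)"

definition IC :: "'a set \<Rightarrow> 'a rel \<Rightarrow> 'a set set" where
  "IC P r = {I. interval_closed P r I}"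

definition toggle :: "'a set \<Rightarrow> 'a rel \<Rightarrow> 'a \<Rightarrow> 'a set \<Rightarrow> 'a set" where
  "toggle P r x I =
     (if x \<in> I \<and> I - {x} \<in> IC P r then I - {x}
      else if x \<notin> I \<and> I \<union> {x} \<in> IC P r then I \<union> {x}
      else I)"

definition linear_extension :: "'a set \<Rightarrow> 'a rel \<Rightarrow> 'a list \<Rightarrow> bool" where
  "linear_extension P r xs \<longleftrightarrow>
     distinct xs \<and> set xs = P \<and>
     (\<forall>i<length xs. \<forall>j<length xs. (xs ! i, xs ! j) \<in> r \<longrightarrow> i \<le> j)"

text \<open>
  Rowmotion computed along the list \<open>[x\<^sub>1, \<dots>, x\<^sub>N]\<close>: the composition
  \<open>t\<^bsub>x\<^sub>1\<^esub> \<circ> \<dots> \<circ> t\<^bsub>x\<^sub>N\<^esub>\<close>, so the toggle at the last entry (at the top of the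
  poset) acts first. It is meant to be used with a linear extension only, and is then
  independent of which linear extension is chosen.
\<close>

definition rowmotion :: "'a set \<Rightarrow> 'a rel \<Rightarrow> 'a list \<Rightarrow> 'a set \<Rightarrow> 'a set" where
  "rowmotion P r xs = foldr (toggle P r) xs"

definition down_closure :: "'a set \<Rightarrow> 'a rel \<Rightarrow> 'a set \<Rightarrow> 'a set" where
  "down_closure P r S = {y \<in> P. \<exists>s\<in>S. (y, s) \<in> r}"

definition up_closure :: "'a set \<Rightarrow> 'a rel \<Rightarrow> 'a set \<Rightarrow> 'a set" where
  "up_closure P r S = {y \<in> P. \<exists>s\<in>S. (s, y) \<in> r}"

definition min_elements :: "'a rel \<Rightarrow> 'a set \<Rightarrow> 'a set" where
  "min_elements r S = {x \<in> S. \<forall>y\<in>S. (y, x) \<in> r \<longrightarrow> y = x}"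

definition incomparable :: "'a set \<Rightarrow> 'a rel \<Rightarrow> 'a set \<Rightarrow> 'a set" where
  "incomparable P r S = {x \<in> P. \<forall>s\<in>S. (x, s) \<notin> r \<and> (s, x) \<notin> r}"

definition ceil :: "'a set \<Rightarrow> 'a rel \<Rightarrow> 'a set \<Rightarrow> 'a set" where
  "ceil P r I = min_elements r (up_closure P r I - I)"

lemma linear_extension_exists:
  assumes "finite P" "partial_order_on P r"
  shows "\<exists>xs. linear_extension P r xs"
proof -
  have "finite r"
    using partial_order_onD(4)[OF assms(2)] assms(1) by (meson finite_SigmaI finite_subset)
  then have wf: "wf (r - Id)"
    using partial_order_on_well_order_on assms(2) by blast
  have "Q \<subseteq> P \<Longrightarrow> \<exists>xs. linear_extension Q r xs" if "finite Q" for Q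
    using that
  proof (induction Q rule: finite_psubset_induct)
    case (psubset Q)
    show ?case
    proof (cases "Q = {}")
      case True
      then show ?thesis by (auto simp: linear_extension_def)
    next
      case False
      then obtain m where m: "m \<in> Q" and min: "\<And>y. (y, m) \<in> r - Id \<Longrightarrow> y \<notin> Q"
        using wf unfolding wf_eq_minimal by (metis ex_in_conv)
      from m psubset.prems obtain xs where xs: "linear_extension (Q - {m}) r xs"
        using psubset.IH[of "Q - {m}"] by blast
      have "i \<le> j" if "i < length (m # xs)" "j < length (m # xs)"
          "((m # xs) ! i, (m # xs) ! j) \<in> r" for i j
      proof (cases i)
        case (Suc i')
        with that(1) have i': "i' < length xs" by simp
        then have "xs ! i' \<in> Q - {m}"
          using xs nth_mem unfolding linear_extension_def by blast
        with min[of "xs ! i'"] have "(xs ! i', m) \<notin> r" by auto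
        with that Suc xs i' show ?thesis
          unfolding linear_extension_def by (cases j) auto
      qed simp
      moreover have "distinct (m # xs)" "set (m # xs) = Q"
        using xs m unfolding linear_extension_def by auto
      ultimately have "linear_extension Q r (m # xs)"
        unfolding linear_extension_def by blast
      then show ?thesis by blast
    qed
  qed
  with assms(1) show ?thesis by blast
qed

end

(*
  Toggling along a linear extension from the top, every x is treated when all elements above it are
  already in their final state and all elements below it are still in their initial state.
  Writing R for the claimed value of Row(I), the state after treating an upper set U
  is (R \<inter> U) \<union> (I - U), by induction on U.  Whether x may be toggled depends only on I
  below x and on R above x, and this local condition says exactly that x changes its status
  if and only if I and R differ at x.
*)
theory Submission
  imports Defs
begin

section \<open>Single toggles on interval-closed sets\<close>

lemma toggle_IC: "I \<in> IC P r \<Longrightarrow> toggle P r x I \<in> IC P r"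
  by (simp add: toggle_def)

lemma toggle_diff: "toggle P r x J - {x} = J - {x}"
  by (auto simp: toggle_def)

lemma IC_subset: "J \<in> IC P r \<Longrightarrow> J \<subseteq> P"
  by (simp add: IC_def interval_closed_def)

lemma IC_convex:
  "J \<in> IC P r \<Longrightarrow> a \<in> J \<Longrightarrow> b \<in> J \<Longrightarrow> z \<in> P \<Longrightarrow> (a, z) \<in> r \<Longrightarrow> (z, b) \<in> r \<Longrightarrow> z \<in> J"
  unfolding IC_def interval_closed_def by blast

lemma IC_I:
  assumes "J \<subseteq> P"
    and "\<And>a b z. a \<in> J \<Longrightarrow> b \<in> J \<Longrightarrow> z \<in> P \<Longrightarrow> (a, z) \<in> r \<Longrightarrow> (z, b) \<in> r \<Longrightarrow> z \<in> J"
  shows "J \<in> IC P r"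
  using assms unfolding IC_def interval_closed_def by blast

text \<open>A gap \<open>z\<close> in \<open>J - {x}\<close> lies in \<open>J\<close> by convexity,
  so only \<open>x\<close> itself can be the gap. The criterion looks at members below
  \<open>x\<close> and above \<open>x\<close> separately.\<close>

lemma toggle_mem_iff_of_mem:
  assumes J: "J \<in> IC P r" and x: "x \<in> J"
  shows "x \<in> toggle P r x J \<longleftrightarrow>
    (\<exists>a\<in>J - {x}. \<exists>b\<in>J - {x}. (a, x) \<in> r \<and> (x, b) \<in> r)" (is "_ \<longleftrightarrow> ?between")
proof -
  have xP: "x \<in> P" using IC_subset[OF J] x by blast
  have "J - {x} \<in> IC P r \<longleftrightarrow> \<not> ?between"
  proof
    assume "J - {x} \<in> IC P r"
    then show "\<not> ?between" using IC_convex[OF _ _ _ xP] by blast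
  next
    assume no: "\<not> ?between"
    show "J - {x} \<in> IC P r"
    proof (rule IC_I)
      fix a b z assume *: "a \<in> J - {x}" "b \<in> J - {x}" "z \<in> P" "(a, z) \<in> r" "(z, b) \<in> r"
      then have "z \<in> J" using IC_convex[OF J] by blast
      moreover have "z \<noteq> x" using * no by blast
      ultimately show "z \<in> J - {x}" by blast
    qed (use IC_subset[OF J] in blast)
  qed
  with x show ?thesis by (simp add: toggle_def)
qed

text \<open>As \<open>J\<close> is already convex, a gap in \<open>J \<union> {x}\<close> must have
  \<open>x\<close> as exactly one endpoint. Each disjunct involves only one side of
  \<open>x\<close>.\<close>

lemma toggle_mem_iff_of_not_mem:
  assumes po: "partial_order_on P r" and J: "J \<in> IC P r" and x: "x \<in> P" "x \<notin> J"
  shows "x \<notin> toggle P r x J \<longleftrightarrow>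
    (\<exists>a\<in>J. \<exists>z\<in>P - J - {x}. (a, z) \<in> r \<and> (z, x) \<in> r) \<or>
    (\<exists>b\<in>J. \<exists>z\<in>P - J - {x}. (x, z) \<in> r \<and> (z, b) \<in> r)" (is "_ \<longleftrightarrow> ?below \<or> ?above")
proof -
  have "J \<union> {x} \<in> IC P r \<longleftrightarrow> \<not> (?below \<or> ?above)"
  proof
    assume "J \<union> {x} \<in> IC P r"
    from IC_convex[OF this] show "\<not> (?below \<or> ?above)" by blast
  next
    assume no: "\<not> (?below \<or> ?above)"
    show "J \<union> {x} \<in> IC P r"
    proof (rule IC_I)
      fix a b z assume *: "a \<in> J \<union> {x}" "b \<in> J \<union> {x}" "z \<in> P" "(a, z) \<in> r" "(z, b) \<in> r"
      consider "a \<in> J" "b \<in> J" | "a \<in> J" "b = x" | "a = x" "b \<in> J" | "a = x" "b = x"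
        using * by blast
      then show "z \<in> J \<union> {x}"
      proof cases
        case 1
        then show ?thesis using IC_convex[OF J] * by blast
      next
        case 4
        then show ?thesis using antisymD[OF partial_order_onD(3)[OF po]] * by blast
      qed (use * no in blast)+
    qed (use IC_subset[OF J] x in blast)
  qed
  with x show ?thesis by (simp add: toggle_def)
qed

section \<open>Linear extensions and minimal elements\<close>

lemma linear_extension_sorted_wrt:
  assumes "linear_extension P r xs"
  shows "sorted_wrt (\<lambda>x y. (y, x) \<notin> r) xs"
  unfolding sorted_wrt_iff_nth_less
proof (intro allI impI notI)
  fix i j assume "i < j" "j < length xs" "(xs ! j, xs ! i) \<in> r"
  moreover from this have "j \<le> i"
    using assms unfolding linear_extension_def by simp
  ultimately show False by simp
qed

text \<open>Descent on the number of elements of \<open>S\<close> below \<open>x\<close>: moving to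
  a smaller \<open>y\<close> loses at least \<open>x\<close>.\<close>

lemma min_elements_below:
  assumes "finite S" "partial_order_on P r" "S \<subseteq> P" "x \<in> S"
  shows "\<exists>m\<in>min_elements r S. (m, x) \<in> r"
proof -
  have refl: "(y, y) \<in> r" if "y \<in> S" for y
    using partial_order_onD(1)[OF assms(2)] assms(3) that by (auto dest: refl_onD)
  have trans: "trans r" and anti: "antisym r"
    using partial_order_onD[OF assms(2)] by auto
  show ?thesis
    using assms(1,4)
  proof (induction "card {y \<in> S. (y, x) \<in> r}" arbitrary: x rule: less_induct)
    case less
    show ?case
    proof (cases "x \<in> min_elements r S")
      case True
      then show ?thesis using refl less.prems by blast
    next
      case False
      then obtain y where y: "y \<in> S" "(y, x) \<in> r" "y \<noteq> x"
        using less.prems by (auto simp: min_elements_def)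
      have "{z \<in> S. (z, y) \<in> r} \<subset> {z \<in> S. (z, x) \<in> r}"
        using y less.prems(2) refl[of x] transD[OF trans _ y(2)] antisymD[OF anti y(2)] by blast
      then have "card {z \<in> S. (z, y) \<in> r} < card {z \<in> S. (z, x) \<in> r}"
        using less.prems(1) by (simp add: psubset_card_mono)
      from less.hyps[OF this less.prems(1) y(1)] show ?thesis
        using transD[OF trans _ y(2)] by blast
    qed
  qed
qed

section \<open>The ceiling and membership in the claimed value\<close>

definition row_formula :: "'a set \<Rightarrow> 'a rel \<Rightarrow> 'a set \<Rightarrow> 'a set" where
  "row_formula P r I =
    (incomparable P r (ceil P r I) - I) \<union>
    (down_closure P r (ceil P r I)
      - down_closure P r (min_elements r I \<inter> down_closure P r (ceil P r I)))"

context
  fixes P I :: "'a set" and r :: "'a rel"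
  assumes finP: "finite P" and po: "partial_order_on P r" and I: "I \<in> IC P r"
begin

lemma I_subset: "I \<subseteq> P"
  using IC_subset[OF I] .

lemma I_convex: "x \<in> I \<Longrightarrow> y \<in> I \<Longrightarrow> (x, z) \<in> r \<Longrightarrow> (z, y) \<in> r \<Longrightarrow> z \<in> I"
  using IC_convex[OF I] partial_order_onD(4)[OF po] by blast

lemma le_refl: "x \<in> P \<Longrightarrow> (x, x) \<in> r"
  using partial_order_onD(1)[OF po] by (rule refl_onD)

lemma le_trans: "(x, y) \<in> r \<Longrightarrow> (y, z) \<in> r \<Longrightarrow> (x, z) \<in> r"
  using partial_order_onD(2)[OF po] by (rule transD)

lemma le_antisym: "(x, y) \<in> r \<Longrightarrow> (y, x) \<in> r \<Longrightarrow> x = y"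
  using partial_order_onD(3)[OF po] by (rule antisymD)

lemma le_carrier: "(x, y) \<in> r \<Longrightarrow> x \<in> P \<and> y \<in> P"
  using partial_order_onD(4)[OF po] by blast

lemma ceilD:
  assumes "c \<in> ceil P r I"
  shows "c \<in> P" "c \<notin> I" "\<exists>a\<in>I. (a, c) \<in> r"
  using assms by (auto simp: ceil_def min_elements_def up_closure_def)

lemma ceil_below:
  assumes "a \<in> I" "(a, z) \<in> r" "z \<notin> I"
  shows "\<exists>c\<in>ceil P r I. (c, z) \<in> r"
  unfolding ceil_def
proof (rule min_elements_below[OF _ po])
  show "z \<in> up_closure P r I - I" using assms le_carrier by (auto simp: up_closure_def)
qed (use finP in \<open>auto simp: up_closure_def\<close>)

lemma ceil_antichain:
  assumes "c \<in> ceil P r I" "d \<in> ceil P r I" "(c, d) \<in> r"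
  shows "c = d"
  using assms by (auto simp: ceil_def min_elements_def)

text \<open>A ceiling element lies above some member of \<open>I\<close>, so being below another one
  would force it into \<open>I\<close> by convexity.\<close>

lemma ceil_not_below: "c \<in> ceil P r I \<Longrightarrow> m \<in> I \<Longrightarrow> (c, m) \<notin> r"
  using ceilD I_convex by blast

lemma row_formula_iff:
  "x \<in> row_formula P r I \<longleftrightarrow> x \<in> P \<and>
    ((x \<notin> I \<and> (\<forall>c\<in>ceil P r I. (x, c) \<notin> r \<and> (c, x) \<notin> r)) \<or>
     ((\<exists>c\<in>ceil P r I. (x, c) \<in> r) \<and>
      \<not> (\<exists>m\<in>min_elements r I. (\<exists>c\<in>ceil P r I. (m, c) \<in> r) \<and> (x, m) \<in> r)))"
  using le_carrier by (auto simp: row_formula_def incomparable_def down_closure_def)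

lemma ceil_row_formula: "c \<in> ceil P r I \<Longrightarrow> c \<in> row_formula P r I"
  unfolding row_formula_iff
  using ceilD(1) le_refl ceil_not_below by (fastforce simp: min_elements_def)

text \<open>This mirrors the criterion for removing \<open>x\<close>, read in \<open>I\<close> below
  \<open>x\<close> and in \<open>row_formula\<close> above. The only minimal element of
  \<open>I\<close> that can lie above \<open>x \<in> I\<close> is \<open>x\<close>, so membership
  means: below the ceiling and not minimal in \<open>I\<close>.\<close>

lemma row_formula_mem_iff_of_mem:
  assumes x: "x \<in> I"
  shows "x \<in> row_formula P r I \<longleftrightarrow>
    (\<exists>a\<in>I - {x}. (a, x) \<in> r) \<and> (\<exists>b\<in>row_formula P r I - {x}. (x, b) \<in> r)"
proof -
  have above: "(\<exists>b\<in>row_formula P r I - {x}. (x, b) \<in> r) \<longleftrightarrow> (\<exists>c\<in>ceil P r I. (x, c) \<in> r)"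
  proof
    assume "\<exists>b\<in>row_formula P r I - {x}. (x, b) \<in> r"
    then obtain b where b: "b \<in> row_formula P r I" "b \<noteq> x" "(x, b) \<in> r" by blast
    show "\<exists>c\<in>ceil P r I. (x, c) \<in> r"
      \<comment> \<open>If \<open>b \<notin> I\<close>, some ceiling element lies below
        \<open>b\<close>, so \<open>b\<close> is not in the incomparable part. In every case
        \<open>b\<close>, and hence \<open>x\<close>, is below the ceiling.\<close>
      using b(1) ceil_below[OF x b(3)] le_trans[OF b(3)] unfolding row_formula_iff by blast
  next
    assume "\<exists>c\<in>ceil P r I. (x, c) \<in> r"
    then show "\<exists>b\<in>row_formula P r I - {x}. (x, b) \<in> r"
      using ceil_row_formula ceilD(2) x by blast
  qed
  have "x = m" if "m \<in> min_elements r I" "(x, m) \<in> r" for m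
    using that x by (auto simp: min_elements_def)
  moreover have "x \<in> min_elements r I \<longleftrightarrow> \<not> (\<exists>a\<in>I - {x}. (a, x) \<in> r)"
    using x by (auto simp: min_elements_def)
  ultimately show ?thesis
    using above x I_subset le_refl[of x] unfolding row_formula_iff[of x] by blast
qed

text \<open>This mirrors the criterion for adding \<open>x\<close>. Exclusion has two causes:
  \<open>x\<close> lies under a minimal element of \<open>I\<close> that is below the ceiling (gap
  above), or \<open>x\<close> lies strictly above the ceiling (gap below).\<close>

lemma row_formula_mem_iff_of_not_mem:
  assumes x: "x \<in> P" "x \<notin> I"
  shows "x \<notin> row_formula P r I \<longleftrightarrow>
    (\<exists>a\<in>I. \<exists>z\<in>P - I - {x}. (a, z) \<in> r \<and> (z, x) \<in> r) \<or>
    (\<exists>b\<in>row_formula P r I. \<exists>z\<in>P - row_formula P r I - {x}. (x, z) \<in> r \<and> (z, b) \<in> r)"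
    (is "_ \<longleftrightarrow> ?below \<or> ?above")
proof
  assume notin: "x \<notin> row_formula P r I"
  show "?below \<or> ?above"
  proof (cases "\<exists>m\<in>min_elements r I. (\<exists>c\<in>ceil P r I. (m, c) \<in> r) \<and> (x, m) \<in> r")
    case True
    then obtain m c where m: "m \<in> min_elements r I" "c \<in> ceil P r I" "(m, c) \<in> r" "(x, m) \<in> r"
      by blast
    have mI: "m \<in> I" using m(1) by (simp add: min_elements_def)
    have "m \<notin> row_formula P r I"
      using m mI I_subset le_refl unfolding row_formula_iff by blast
    \<comment> \<open>The gap is \<open>z = m\<close>, the upper endpoint is the ceiling element
      \<open>c\<close>.\<close>
    then have ?above using m mI x I_subset ceil_row_formula by blast
    then show ?thesis ..
  next
    case False
    with notin x obtain c where c: "c \<in> ceil P r I" "(c, x) \<in> r" "(x, c) \<notin> r"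
      unfolding row_formula_iff by blast
    then have "c \<noteq> x" using le_refl x by blast
    then have ?below using c ceilD by blast
    then show ?thesis ..
  qed
next
  assume "?below \<or> ?above"
  then show "x \<notin> row_formula P r I"
  proof
    assume ?below
    then obtain a z where "a \<in> I" "z \<notin> I" "z \<noteq> x" "(a, z) \<in> r" "(z, x) \<in> r" by blast
    then obtain c where c: "c \<in> ceil P r I" "(c, z) \<in> r" using ceil_below by blast
    \<comment> \<open>Being above \<open>c\<close>, \<open>x\<close> cannot also be below the
      ceiling: \<open>x\<close> below \<open>d\<close> would give \<open>c = d\<close> and squeeze
      \<open>z\<close> onto \<open>x\<close>.\<close>
    have False if "d \<in> ceil P r I" "(x, d) \<in> r" for d
    proof -
      have "c = d"
        using ceil_antichain[OF c(1) that(1)] c(2) \<open>(z, x) \<in> r\<close> that(2) le_trans by blast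
      then show False
        using c(2) \<open>(z, x) \<in> r\<close> \<open>z \<noteq> x\<close> that(2) le_trans le_antisym by metis
    qed
    then show ?thesis
      using c le_trans[OF c(2) \<open>(z, x) \<in> r\<close>] unfolding row_formula_iff by blast
  next
    assume ?above
    then obtain b z where b: "b \<in> row_formula P r I" and z: "z \<in> P" "z \<notin> row_formula P r I"
      and xz: "(x, z) \<in> r" and zb: "(z, b) \<in> r" by blast
    \<comment> \<open>Such a \<open>z\<close> is excluded by a minimal element of \<open>I\<close>
      above it, which then excludes \<open>x\<close> as well.\<close>
    have below_ceil: "x \<notin> row_formula P r I"
      if "d \<in> ceil P r I" "(z, d) \<in> r" for d
      using that z le_trans[OF xz] unfolding row_formula_iff by blast
    show ?thesis
    proof (cases "\<exists>d\<in>ceil P r I. (z, d) \<in> r")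
      case True
      then show ?thesis using below_ceil by blast
    next
      case False
      \<comment> \<open>Since \<open>z\<close> is not below the ceiling, neither is
        \<open>b\<close>, so \<open>b\<close> comes from the incomparable part. This passes down to
        \<open>z\<close>, contradicting the choice of \<open>z\<close>.\<close>
      then have inc: "\<And>c. c \<in> ceil P r I \<Longrightarrow> (b, c) \<notin> r \<and> (c, b) \<notin> r" and "b \<notin> I"
        using b le_trans[OF zb] unfolding row_formula_iff by blast+
      have "z \<notin> I" using ceil_below[OF _ zb \<open>b \<notin> I\<close>] inc by blast
      then have "z \<in> row_formula P r I"
        using z(1) False inc le_trans[OF _ zb] unfolding row_formula_iff by blast
      with z(2) show ?thesis by blast
    qed
  qed
qed

section \<open>Induction along the linear extension\<close>

lemma toggle_step:
  assumes J: "(row_formula P r I \<inter> U) \<union> (I - U) \<in> IC P r" and x: "x \<in> P" "x \<notin> U"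
    and above: "\<And>y. (x, y) \<in> r \<Longrightarrow> y \<noteq> x \<Longrightarrow> y \<in> U"
    and below: "\<And>y. (y, x) \<in> r \<Longrightarrow> y \<notin> U"
  shows "toggle P r x ((row_formula P r I \<inter> U) \<union> (I - U)) =
    (row_formula P r I \<inter> insert x U) \<union> (I - insert x U)"
proof -
  let ?R = "row_formula P r I" and ?J = "(row_formula P r I \<inter> U) \<union> (I - U)"
  have up: "y \<in> ?J \<longleftrightarrow> y \<in> ?R" if "(x, y) \<in> r" "y \<noteq> x" for y
    using above[OF that] by blast
  have down: "y \<in> ?J \<longleftrightarrow> y \<in> I" if "(y, x) \<in> r" for y
    using below[OF that] by blast
  have "x \<in> toggle P r x ?J \<longleftrightarrow> x \<in> ?R"
  proof (cases "x \<in> I")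
    case True
    then have "x \<in> ?J" using x by blast
    then show ?thesis
      unfolding toggle_mem_iff_of_mem[OF J \<open>x \<in> ?J\<close>] row_formula_mem_iff_of_mem[OF True]
      using up down by blast
  next
    case False
    then have xJ: "x \<notin> ?J" using x by blast
    have "(\<exists>a\<in>?J. \<exists>z\<in>P - ?J - {x}. (a, z) \<in> r \<and> (z, x) \<in> r) \<longleftrightarrow>
        (\<exists>a\<in>I. \<exists>z\<in>P - I - {x}. (a, z) \<in> r \<and> (z, x) \<in> r)"
    proof -
      have "a \<in> ?J \<longleftrightarrow> a \<in> I" if "(a, z) \<in> r" "(z, x) \<in> r" for a z
        using down le_trans[OF that] by blast
      with down show ?thesis by (intro iffI; (elim bexE conjE; fast))
    qed
    moreover have "b \<in> ?J \<longleftrightarrow> b \<in> ?R" if "(x, z) \<in> r" "z \<noteq> x" "(z, b) \<in> r" for z b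
      \<comment> \<open>Here \<open>b\<close> differs from \<open>x\<close>, since otherwise
        antisymmetry would give \<open>z = x\<close>.\<close>
      using up[of b] that le_trans[OF that(1,3)] le_antisym[OF that(1)] by blast
    then have "(\<exists>b\<in>?J. \<exists>z\<in>P - ?J - {x}. (x, z) \<in> r \<and> (z, b) \<in> r) \<longleftrightarrow>
        (\<exists>b\<in>?R. \<exists>z\<in>P - ?R - {x}. (x, z) \<in> r \<and> (z, b) \<in> r)"
      using up by (intro iffI; (elim bexE conjE; fast))
    ultimately have "x \<notin> toggle P r x ?J \<longleftrightarrow> x \<notin> ?R"
      unfolding toggle_mem_iff_of_not_mem[OF po J x(1) xJ]
        row_formula_mem_iff_of_not_mem[OF x(1) False]
      by (rule arg_cong2[where f = "(\<or>)"])
    then show ?thesis by blast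
  qed
  \<comment> \<open>Away from \<open>x\<close> neither the toggle nor the enlargement of
    \<open>U\<close> changes anything.\<close>
  with toggle_diff[of P r x ?J] show ?thesis by blast
qed

text \<open>\<open>ys\<close> runs through the suffixes of a linear extension, and
  \<open>foldr\<close> treats the last entry first. Membership in \<open>IC\<close> is carried along
  because \<open>toggle_step\<close> requires it of the current state.\<close>

lemma foldr_toggle:
  assumes "linear_extension P r (zs @ ys)"
  shows "foldr (toggle P r) ys I = (row_formula P r I \<inter> set ys) \<union> (I - set ys) \<and>
    foldr (toggle P r) ys I \<in> IC P r"
  using assms
proof (induction ys arbitrary: zs)
  case Nil
  then show ?case using I by simp
next
  case (Cons x ys)
  from Cons.prems have "linear_extension P r ((zs @ [x]) @ ys)" by simp
  note IH = Cons.IH[OF this]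
  have set: "set (zs @ x # ys) = P" and "distinct (zs @ x # ys)"
    using Cons.prems unfolding linear_extension_def by auto
  have srt: "sorted_wrt (\<lambda>x y. (y, x) \<notin> r) (zs @ x # ys)"
    using linear_extension_sorted_wrt[OF Cons.prems] .
  have "toggle P r x ((row_formula P r I \<inter> set ys) \<union> (I - set ys)) =
      (row_formula P r I \<inter> insert x (set ys)) \<union> (I - insert x (set ys))"
  proof (rule toggle_step)
    show "y \<in> set ys" if "(x, y) \<in> r" "y \<noteq> x" for y
      \<comment> \<open>An element strictly above \<open>x\<close> cannot occur in the prefix
        \<open>zs\<close>, so it has been treated already.\<close>
      using that set srt le_carrier[OF that(1)] by (auto simp: sorted_wrt_append)
    show "y \<notin> set ys" if "(y, x) \<in> r" for y
      using that srt by (auto simp: sorted_wrt_append)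
  qed (use IH set \<open>distinct _\<close> in auto)
  with IH have "foldr (toggle P r) (x # ys) I =
      (row_formula P r I \<inter> set (x # ys)) \<union> (I - set (x # ys))"
    by simp
  moreover have "foldr (toggle P r) (x # ys) I \<in> IC P r"
    using toggle_IC[OF conjunct2[OF IH]] by simp
  ultimately show ?case by (rule conjI)
qed

end

theorem theorem1p1:
  fixes P I :: "'a set" and r :: "'a rel" and xs :: "'a list"
  assumes "finite P" and "partial_order_on P r"
    and "linear_extension P r xs"
    and "I \<in> IC P r"
  shows "rowmotion P r xs I =
    (incomparable P r (ceil P r I) - I) \<union>
    (down_closure P r (ceil P r I)
      - down_closure P r (min_elements r I \<inter> down_closure P r (ceil P r I)))"
proof -
  have "set xs = P" "I \<subseteq> P"
    using assms(3) IC_subset[OF assms(4)] by (simp_all add: linear_extension_def)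
  moreover have "row_formula P r I \<subseteq> P"
    by (auto simp: row_formula_def incomparable_def down_closure_def)
  ultimately have "rowmotion P r xs I = row_formula P r I"
    \<comment> \<open>With empty prefix the treated set is all of \<open>P\<close>, so nothing of
      the initial \<open>I\<close> remains.\<close>
    using foldr_toggle[OF assms(1,2,4), of "[]" xs] assms(3) by (auto simp: rowmotion_def)
  then show ?thesis by (simp only: row_formula_def)
qed

end
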